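(* Let $a\in(0,1)^r$ be a maximal representable tuple, let $(a_{ij})$ be an arbitrary generator of $a$, and let $H_a$ be defined with respect to it. Then there exists $\varepsilon>0$ such that every $a'\in H_a$ with $\|a'-a\|\le\varepsilon$ is representable.
   Context: Fix an integer $r\ge2$ and write $[r]=\{1,\dots,r\}$. A generator is a vector $(a_{ij})_{i\neq j\in[r]}$ with $0\le a_{ij}\le 1$ and $a_{ij}+a_{ji}\le 1$ for all $i\neq j$. It generates the tuple $(a_1,\dots,a_r)$ with $a_i=\prod_{j\neq i}a_{ij}$. A tuple in $\mathbb R^r_{\ge0}$ is representable if some generator generates it. A representable tuple $a$ is maximal if there is no representable $a'\neq a$ with $a'_i\ge a_i$ for all $i$. For $a\in(0,1)^r$ and a generator $(a_{ij})$ of $a$, the movement vectors $w_{ij}$, $i\neq j\in[r]$, are given by $(w_{ij})_i=a_i/a_{ij}$, $(w_{ij})_j=-a_j/a_{ji}$, and $(w_{ij})_k=0$ for $k\notin\{i,j\}$; and $H_a=\{a+\sum_{i\neq j}\alpha_{ij}w_{ij}:\alpha_{ij}\in\mathbb R\}$. The norm is Euclidean. *)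

theory Defs
  imports "HOL-Analysis.Analysis"
begin

(* The index set [r] is a finite type 'r with CARD('r) = r.  A generator is a function g with
   g i j = a_ij for i \<noteq> j; the diagonal values g i i are junk and are never used. *)

definition is_generator :: "('r::finite \<Rightarrow> 'r \<Rightarrow> real) \<Rightarrow> bool" where
  "is_generator g \<longleftrightarrow> (\<forall>i j. i \<noteq> j \<longrightarrow> 0 \<le> g i j \<and> g i j \<le> 1 \<and> g i j + g j i \<le> 1)"

definition generated_tuple :: "('r::finite \<Rightarrow> 'r \<Rightarrow> real) \<Rightarrow> real ^ 'r" where
  "generated_tuple g = (\<chi> i. \<Prod>j\<in>UNIV - {i}. g i j)"

definition generates :: "('r::finite \<Rightarrow> 'r \<Rightarrow> real) \<Rightarrow> real ^ 'r \<Rightarrow> bool" where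
  "generates g a \<longleftrightarrow> is_generator g \<and> a = generated_tuple g"

(* Nonnegativity of the entries of a is automatic. *)
definition representable :: "real ^ 'r::finite \<Rightarrow> bool" where
  "representable a \<longleftrightarrow> (\<exists>g. generates g a)"

definition maximal_representable :: "real ^ 'r::finite \<Rightarrow> bool" where
  "maximal_representable a \<longleftrightarrow>
     representable a \<and> \<not> (\<exists>a'. representable a' \<and> a' \<noteq> a \<and> (\<forall>i. a' $ i \<ge> a $ i))"

(* Only meaningful for i \<noteq> j. *)
definition movement_vector ::
    "('r::finite \<Rightarrow> 'r \<Rightarrow> real) \<Rightarrow> real ^ 'r \<Rightarrow> 'r \<Rightarrow> 'r \<Rightarrow> real ^ 'r" where
  "movement_vector g a i j =
     (\<chi> k. if k = i then a $ i / g i j else if k = j then - (a $ j / g j i) else 0)"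

definition movement_space :: "('r::finite \<Rightarrow> 'r \<Rightarrow> real) \<Rightarrow> real ^ 'r \<Rightarrow> (real ^ 'r) set" where
  "movement_space g a =
     {a + (\<Sum>(i, j)\<in>{(i, j). i \<noteq> j}. \<alpha> i j *\<^sub>R movement_vector g a i j) | \<alpha>. True}"

end

(* If some antisymmetric perturbation of the generator increased every entry of the tuple to first
   order, maximality would fail.  By separation there is therefore a nonzero functional l \<ge> 0 that
   vanishes on all movement vectors, i.e. l_i a_i / g_ij = l_j a_j / g_ji for all i \<noteq> j, which forces
   l > 0.  A displacement v in the span of the movement vectors satisfies \<Sum> l_i v_i = 0, so it is
   realised to first order by a flow of size l_i v_i from the indices with l_i v_i > 0 to those with
   l_i v_i < 0.  In such a flow all perturbations of the row of i have the same sign, so the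
   Weierstrass product inequality shows that the exact product is at least the linear
   approximation a_i + v_i; representability is inherited by smaller tuples. *)

theory Submission
  imports Defs
begin

section \<open>Tools: product inequality, flows, separation\<close>

text \<open>Expanding one factor reduces the induction step to \<open>x k \<le> x k * ?P\<close>,
  which holds because \<open>x k\<close> and \<open>?P - 1\<close> have the same sign: the product
  is at least 1 for nonnegative entries and at most 1 for entries in [-1, 0].\<close>

lemma one_plus_sum_le_prod:
  fixes x :: "'a \<Rightarrow> real"
  assumes "finite A" and "(\<forall>i\<in>A. 0 \<le> x i) \<or> (\<forall>i\<in>A. -1 \<le> x i \<and> x i \<le> 0)"
  shows "1 + (\<Sum>i\<in>A. x i) \<le> (\<Prod>i\<in>A. 1 + x i)"
  using assms
proof (induction A rule: finite_induct)
  case (insert k A)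
  let ?P = "\<Prod>i\<in>A. 1 + x i"
  have IH: "1 + (\<Sum>i\<in>A. x i) \<le> ?P"
    using insert by auto
  have "x k \<le> x k * ?P"
  proof (cases "\<forall>i\<in>insert k A. 0 \<le> x i")
    case True
    then have "1 \<le> ?P" by (intro prod_ge_1) auto
    then show ?thesis using True by (simp add: mult_le_cancel_left1)
  next
    case False
    then have *: "\<forall>i\<in>insert k A. -1 \<le> x i \<and> x i \<le> 0" using insert.prems by auto
    then have "?P \<le> 1" by (intro prod_le_1) force
    then show ?thesis using * by (simp add: mult_le_cancel_left1)
  qed
  then show ?case using IH insert.hyps by (simp add: algebra_simps)
qed simp

text \<open>Read \<open>x\<close> as supplies and demands. The positive part \<open>p\<close> and
  the negative part \<open>n\<close> have the same total \<open>S\<close>, so each source can ship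
  \<open>p i * n j / S\<close> to \<open>j\<close>, in proportion to demand. Every index is a pure
  source or a pure sink, so its row has one sign, and shares at most 1 bound each entry by
  \<open>x i\<close>.\<close>

lemma antisymmetric_flow_exists:
  fixes x :: "'r::finite \<Rightarrow> real"
  assumes "(\<Sum>i\<in>UNIV. x i) = 0"
  obtains u where "\<And>i j. u j i = - u i j" and "\<And>i. (\<Sum>j\<in>UNIV. u i j) = x i"
    and "\<And>i j. 0 \<le> x i \<Longrightarrow> 0 \<le> u i j \<and> u i j \<le> x i"
    and "\<And>i j. x i \<le> 0 \<Longrightarrow> x i \<le> u i j \<and> u i j \<le> 0"
proof -
  define p n where "p i = max (x i) 0" and "n i = max (- x i) 0" for i
  define S where "S = (\<Sum>i\<in>UNIV. p i)"
  have nonneg: "0 \<le> p i" "0 \<le> n i" for i by (auto simp: p_def n_def)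
  have pn: "p i - n i = x i" for i by (auto simp: p_def n_def)
  have Sn: "S = (\<Sum>i\<in>UNIV. n i)"
    using assms unfolding S_def pn[symmetric] by (simp add: sum_subtractf)
  have le: "p i \<le> S" "n i \<le> S" for i
    using member_le_sum[of i UNIV p] member_le_sum[of i UNIV n] nonneg
    by (auto simp: S_def) (simp add: Sn[unfolded S_def])
  \<comment> \<open>If \<open>S = 0\<close> then \<open>x = 0\<close>, and \<open>u = 0\<close> since \<open>1 / 0 = 0\<close>.\<close>
  define u where "u i j = (p i * n j - n i * p j) / S" for i j
  have frac: "0 \<le> p i * n j / S" "p i * n j / S \<le> p i" "0 \<le> n i * p j / S" "n i * p j / S \<le> n i" for i j
  proof -
    have "0 \<le> S" using le(1)[of i] nonneg(1)[of i] by linarith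
    moreover have "p i * n j \<le> p i * S" "n i * p j \<le> n i * S"
      using le nonneg by (auto intro: mult_left_mono)
    ultimately show "0 \<le> p i * n j / S" "p i * n j / S \<le> p i"
      "0 \<le> n i * p j / S" "n i * p j / S \<le> n i"
      using nonneg[of i] nonneg[of j] by (auto simp: divide_le_eq)
  qed
  show thesis
  proof
    show "u j i = - u i j" for i j by (simp add: u_def minus_divide_left algebra_simps)
    show "(\<Sum>j\<in>UNIV. u i j) = x i" for i
    proof (cases "S = 0")
      case True
      then have "x i = 0" using le[of i] nonneg[of i] pn[of i] by linarith
      then show ?thesis using True by (simp add: u_def)
    next
      case False
      have "(\<Sum>j\<in>UNIV. u i j) = (p i * S - n i * S) / S"
        unfolding u_def sum_divide_distrib[symmetric] sum_subtractf sum_distrib_left[symmetric]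
        by (simp add: S_def[symmetric] Sn[symmetric])
      then show ?thesis using False pn[of i] by (simp add: diff_divide_distrib)
    qed
    show "0 \<le> u i j \<and> u i j \<le> x i" if "0 \<le> x i" for i j
      using that frac[of i j] by (auto simp: u_def n_def p_def max_def split: if_splits)
    show "x i \<le> u i j \<and> u i j \<le> 0" if "x i \<le> 0" for i j
      using that frac[of i j] by (auto simp: u_def n_def p_def max_def split: if_splits)
  qed
qed

text \<open>Gordan's alternative for a subspace, by separating \<open>S\<close> from the open
  positive orthant: a functional bounded above on a subspace vanishes there, and one bounded below
  on the orthant has no negative coordinate.\<close>

lemma gordan:
  fixes S :: "(real ^ 'n::finite) set"
  assumes "subspace S" and "\<not> (\<exists>x\<in>S. \<forall>i. 0 < x $ i)"
  obtains l where "l \<noteq> 0" and "\<And>i. 0 \<le> l $ i" and "\<And>x. x \<in> S \<Longrightarrow> l \<bullet> x = 0"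
proof -
  define T where "T = {x :: real ^ 'n. \<forall>i. 0 < x $ i}"
  have "T = (\<Inter>i. {x. 0 < axis i 1 \<bullet> x})"
    by (auto simp: T_def inner_axis')
  then have "convex T" by (auto intro: convex_halfspace_gt convex_INT)
  moreover have "1 \<in> T" by (simp add: T_def)
  moreover have "S \<inter> T = {}" using assms(2) by (auto simp: T_def)
  ultimately obtain l b where l: "l \<noteq> 0" "\<forall>x\<in>S. l \<bullet> x \<le> b" "\<forall>x\<in>T. b \<le> l \<bullet> x"
    using separating_hyperplane_sets[of S T] assms(1) subspace_imp_convex subspace_0
    by (metis empty_iff)
  have b: "0 \<le> b" using l(2) subspace_0[OF assms(1)] by force
  have "l \<bullet> x = 0" if "x \<in> S" for x
  proof (rule ccontr)
    assume neq: "l \<bullet> x \<noteq> 0"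
    \<comment> \<open>The multiple of \<open>x\<close> at which \<open>l\<close> takes the value
      \<open>b + 1\<close>, exceeding the bound.\<close>
    have "((b + 1) / (l \<bullet> x)) *\<^sub>R x \<in> S" using assms(1) that by (simp add: subspace_scale)
    then have "l \<bullet> (((b + 1) / (l \<bullet> x)) *\<^sub>R x) \<le> b" using l(2) by blast
    then show False using neq by simp
  qed
  moreover have "0 \<le> l $ i" for i
  proof (rule ccontr)
    assume neg: "\<not> 0 \<le> l $ i"
    \<comment> \<open>Chosen so that moving by \<open>c\<close> along axis \<open>i\<close> lowers
      the value of \<open>l\<close> at \<open>1\<close> by
      \<open>\<bar>l \<bullet> 1\<bar> + 1\<close>, making it negative.\<close>
    define c where "c = (\<bar>l \<bullet> 1\<bar> + 1) / (- (l $ i))"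
    have "0 \<le> c" using neg unfolding c_def by (intro divide_nonneg_pos) auto
    then have "1 + c *\<^sub>R axis i 1 \<in> T" by (auto simp: T_def axis_def)
    then have "0 \<le> l \<bullet> (1 + c *\<^sub>R axis i 1)" using l(3) b by force
    also have "\<dots> = l \<bullet> 1 + c * l $ i" by (simp add: inner_add_right inner_axis)
    also have "c * l $ i = - (\<bar>l \<bullet> 1\<bar> + 1)" using neg by (simp add: c_def)
    finally show False by linarith
  qed
  ultimately show thesis using l(1) that by blast
qed

section \<open>Generators and representable tuples\<close>

text \<open>Shrinking entries of a generator keeps it a generator, so it suffices to scale a single
  factor per row, the one in column \<open>s i\<close>; a second index makes such a column
  available.\<close>

lemma representable_mono:
  fixes a b :: "real ^ 'r::finite"
  assumes "CARD('r) \<ge> 2" and "representable b" and "\<And>i. 0 \<le> a $ i" and "\<And>i. a $ i \<le> b $ i"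
  shows "representable a"
proof -
  obtain g where g: "is_generator g" "b = generated_tuple g"
    using assms(2) by (auto simp: representable_def generates_def)
  have "\<exists>k. k \<noteq> i" for i :: 'r
  proof (rule ccontr)
    assume "\<not> ?thesis"
    then have "(UNIV :: 'r set) = {i}" by auto
    then have "CARD('r) = 1" by (metis card_1_singleton_iff One_nat_def)
    then show False using assms(1) by simp
  qed
  then obtain s :: "'r \<Rightarrow> 'r" where s: "s i \<noteq> i" for i by metis
  \<comment> \<open>If \<open>b $ i = 0\<close>, then \<open>a $ i = 0\<close> too and division by
    zero gives \<open>c i = 0\<close>, so \<open>c i * b $ i = a $ i\<close> still holds.\<close>
  define c where "c i = a $ i / b $ i" for i
  have c: "0 \<le> c i" "c i \<le> 1" for i
    using assms(3)[of i] assms(4)[of i] by (auto simp: c_def divide_le_eq_1)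
  define h where "h i j = (if j = s i then c i else 1) * g i j" for i j
  have h: "0 \<le> h i j \<and> h i j \<le> g i j" if "i \<noteq> j" for i j
    using g(1) that c[of i] by (auto simp: h_def is_generator_def mult_left_le_one_le)
  have "is_generator h"
    unfolding is_generator_def
  proof (intro allI impI)
    fix i j :: 'r assume "i \<noteq> j"
    moreover from this have "g i j \<le> 1" "g i j + g j i \<le> 1"
      using g(1) by (auto simp: is_generator_def)
    ultimately show "0 \<le> h i j \<and> h i j \<le> 1 \<and> h i j + h j i \<le> 1"
      using h[of i j] h[of j i] by auto
  qed
  moreover have "a = generated_tuple h"
  proof -
    have "generated_tuple h $ i = c i * b $ i" for i
      using s[of i] by (simp add: generated_tuple_def h_def g(2) prod.distrib)
    moreover have "c i * b $ i = a $ i" for i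
      using assms(3)[of i] assms(4)[of i] by (auto simp: c_def)
    ultimately show ?thesis by (simp add: vec_eq_iff)
  qed
  ultimately show ?thesis by (auto simp: representable_def generates_def)
qed

lemma generator_pos:
  assumes "generates g a" and "\<And>i. 0 < a $ i" and "i \<noteq> j"
  shows "0 < g i j"
proof -
  have "0 < (\<Prod>j\<in>UNIV - {i}. g i j)"
    using assms(1) assms(2)[of i] by (simp add: generates_def generated_tuple_def)
  moreover have "(\<Prod>j\<in>UNIV - {i}. g i j) = 0" if "g i j = 0"
    using that assms(3) by (intro prod_zero) auto
  ultimately have "g i j \<noteq> 0" by (metis less_irrefl)
  then show ?thesis using assms(1,3) by (force simp: generates_def is_generator_def)
qed

section \<open>First-order conditions at a maximal tuple\<close>

text \<open>Along \<open>g + s * t\<close> antisymmetry fixes all sums \<open>g i j + g j i\<close>,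
  and every entry of the tuple has positive derivative at \<open>s = 0\<close>. A small
  \<open>s > 0\<close> thus gives a strictly larger tuple with positive generator entries; the bound
  by 1 follows from the pair sums.\<close>

lemma increasing_perturbation_not_maximal:
  fixes a :: "real ^ 'r::finite"
  assumes gen: "generates g a" and pos: "\<And>i. 0 < a $ i"
    and antisym: "\<And>i j. t j i = - t i j"
    and incr: "\<And>i. 0 < (\<Sum>j\<in>UNIV - {i}. t i j / g i j)"
  shows "\<not> maximal_representable a"
proof -
  note gpos = generator_pos[OF gen pos]
  have a: "a $ i = (\<Prod>j\<in>UNIV - {i}. g i j)" for i
    using gen by (simp add: generates_def generated_tuple_def)
  have g: "is_generator g" using gen by (simp add: generates_def)
  define h where "h s i j = g i j + s * t i j" for s i j
  have "\<forall>\<^sub>F s in at_right 0. a $ i < generated_tuple (h s) $ i" for i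
  proof -
    let ?f = "\<lambda>s. generated_tuple (h s) $ i"
    have "(?f has_real_derivative
        (\<Prod>j\<in>UNIV - {i}. h 0 i j) * (\<Sum>j\<in>UNIV - {i}. t i j / h 0 i j)) (at 0)"
      unfolding generated_tuple_def vec_lambda_beta
      by (intro has_field_derivative_prod')
         (use gpos[of i] in \<open>force simp: h_def intro!: derivative_eq_intros\<close>)+
    then have "\<exists>d>0. \<forall>s>0. s < d \<longrightarrow> ?f 0 < ?f (0 + s)"
      by (rule DERIV_pos_inc_right) (use incr[of i] pos[of i] in \<open>simp add: h_def a\<close>)
    then show ?thesis
      by (auto simp: eventually_at_right_field h_def a generated_tuple_def)
  qed
  then have 1: "\<forall>\<^sub>F s in at_right 0. \<forall>i. a $ i < generated_tuple (h s) $ i"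
    by (rule eventually_all_finite)
  have "\<forall>\<^sub>F s in at_right 0. i \<noteq> j \<longrightarrow> 0 < h s i j" for i j
  proof (cases "i = j")
    case False
    have "((\<lambda>s. h s i j) \<longlongrightarrow> h 0 i j) (at_right 0)"
      unfolding h_def by (intro tendsto_intros)
    then show ?thesis
      using order_tendstoD(1)[of _ _ _ 0] gpos[OF False] by (force simp: h_def elim: eventually_mono)
  qed simp
  then have 2: "\<forall>\<^sub>F s in at_right 0. \<forall>i j. i \<noteq> j \<longrightarrow> 0 < h s i j"
    by (intro eventually_all_finite)
  obtain s where s: "\<forall>i. a $ i < generated_tuple (h s) $ i" "\<forall>i j. i \<noteq> j \<longrightarrow> 0 < h s i j"
    using eventually_happens'[OF _ eventually_conj[OF 1 2]] by auto
  have sum1: "h s i j + h s j i \<le> 1" if "i \<noteq> j" for i j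
    using g that antisym[of i j] by (simp add: h_def is_generator_def)
  have "is_generator (h s)"
    unfolding is_generator_def
  proof (intro allI impI)
    fix i j :: 'r assume "i \<noteq> j"
    moreover from this have "0 < h s i j" "0 < h s j i" using s(2) by auto
    ultimately show "0 \<le> h s i j \<and> h s i j \<le> 1 \<and> h s i j + h s j i \<le> 1"
      using sum1[of i j] by auto
  qed
  then have "representable (generated_tuple (h s))"
    by (auto simp: representable_def generates_def)
  moreover have "generated_tuple (h s) \<noteq> a" using s(1) by force
  ultimately show ?thesis
    using s(1) unfolding maximal_representable_def by (meson less_imp_le)
qed

lemma maximal_imp_balanced:
  fixes a :: "real ^ 'r::finite"
  assumes max: "maximal_representable a" and gen: "generates g a" and pos: "\<And>i. 0 < a $ i"
  obtains l :: "real ^ 'r" where "\<And>i. 0 < l $ i"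
    and "\<And>i j. i \<noteq> j \<Longrightarrow> l $ i * a $ i / g i j = l $ j * a $ j / g j i"
proof -
  note gpos = generator_pos[OF gen pos]
  \<comment> \<open>\<open>D t\<close> is the derivative at \<open>s = 0\<close> of the tuple
    generated by \<open>g + s * t\<close>.\<close>
  define D :: "('r \<Rightarrow> 'r \<Rightarrow> real) \<Rightarrow> real ^ 'r"
    where "D t = (\<chi> i. a $ i * (\<Sum>j\<in>UNIV - {i}. t i j / g i j))" for t
  define S where "S = {D t | t. \<forall>i j. t j i = - t i j}"
  have "subspace S"
  proof (rule subspaceI)
    have "0 = D (\<lambda>i j. 0)" by (simp add: D_def vec_eq_iff)
    then show "0 \<in> S" unfolding S_def by force
  next
    fix x y assume "x \<in> S" "y \<in> S"
    then obtain t u where *: "x = D t" "\<forall>i j. t j i = - t i j" "y = D u" "\<forall>i j. u j i = - u i j"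
      unfolding S_def by blast
    have "x + y = D (\<lambda>i j. t i j + u i j)"
      by (simp add: *(1,3) D_def vec_eq_iff add_divide_distrib sum.distrib distrib_left)
    moreover have "t j i + u j i = - (t i j + u i j)" for i j
      using *(2)[rule_format, of i j] *(4)[rule_format, of i j] by simp
    ultimately show "x + y \<in> S" unfolding S_def by blast
  next
    fix c :: real and x assume "x \<in> S"
    then obtain t where *: "x = D t" "\<forall>i j. t j i = - t i j"
      unfolding S_def by blast
    have "c *\<^sub>R x = D (\<lambda>i j. c * t i j)"
      by (simp add: *(1) D_def vec_eq_iff sum_distrib_left mult_ac)
    moreover have "c * t j i = - (c * t i j)" for i j
      using *(2)[rule_format, of i j] by simp
    ultimately show "c *\<^sub>R x \<in> S" unfolding S_def by blast
  qed
  moreover have "\<not> (\<exists>x\<in>S. \<forall>i. 0 < x $ i)"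
  proof
    assume "\<exists>x\<in>S. \<forall>i. 0 < x $ i"
    then obtain t where t: "\<forall>i j. t j i = - t i j" "\<forall>i. 0 < D t $ i"
      unfolding S_def by blast
    have "0 < (\<Sum>j\<in>UNIV - {i}. t i j / g i j)" for i
      using t(2) pos[of i] by (simp add: D_def zero_less_mult_iff) (metis less_asym)
    then show False
      using increasing_perturbation_not_maximal[OF gen pos, of t] t(1) max by blast
  qed
  ultimately obtain l where l: "l \<noteq> 0" "\<And>i. 0 \<le> l $ i" "\<And>x. x \<in> S \<Longrightarrow> l \<bullet> x = 0"
    by (rule gordan) blast
  have bal: "l $ i * a $ i / g i j = l $ j * a $ j / g j i" if ij: "i \<noteq> j" for i j
  proof -
    \<comment> \<open>A unit transfer from \<open>g j i\<close> to \<open>g i j\<close> alone: its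
      \<open>D t\<close> is the movement vector of \<open>i\<close> and \<open>j\<close>, and
      orthogonality to \<open>l\<close> is the balance equation.\<close>
    define t :: "'r \<Rightarrow> 'r \<Rightarrow> real"
      where "t p q = (if p = i \<and> q = j then 1 else if p = j \<and> q = i then -1 else 0)" for p q
    have "\<forall>p q. t q p = - t p q" using ij by (auto simp: t_def)
    then have "l \<bullet> D t = 0" using l(3) unfolding S_def by blast
    moreover have "D t = (a $ i / g i j) *\<^sub>R axis i 1 - (a $ j / g j i) *\<^sub>R axis j 1"
    proof -
      have "(\<Sum>q\<in>UNIV - {k}. t k q / g k q)
        = (if k = i then 1 / g i j else if k = j then - (1 / g j i) else 0)" for k
      proof -
        \<comment> \<open>Row \<open>k\<close> of \<open>t\<close> has at most one nonzero entry; if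
          \<open>k\<close> is neither \<open>i\<close> nor \<open>j\<close>, the selected column
          \<open>i\<close> contributes zero.\<close>
        have "(\<Sum>q\<in>UNIV - {k}. t k q / g k q) = (\<Sum>q\<in>UNIV - {k}.
            if q = (if k = i then j else i) then t k q / g k q else 0)"
          by (rule sum.cong) (auto simp: t_def)
        then show ?thesis using ij by (simp add: t_def)
      qed
      then show ?thesis using ij by (simp add: D_def vec_eq_iff axis_def)
    qed
    ultimately show ?thesis by (simp add: inner_diff_right inner_axis mult.commute)
  qed
  obtain k where k: "0 < l $ k"
    using l(1,2) by (metis less_eq_real_def vec_eq_iff zero_index)
  \<comment> \<open>The balance equation carries positivity from \<open>k\<close> to every other
    index.\<close>
  have "0 < l $ i" for i
  proof (cases "i = k")
    case False
    have "0 < l $ k * a $ k / g k i" using k pos gpos False by simp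
    then have "l $ i \<noteq> 0" using bal[OF False] by auto
    then show ?thesis using l(2)[of i] by simp
  qed (use k in simp)
  then show thesis using bal that by blast
qed

section \<open>Realising small displacements\<close>

lemma representable_add_balanced:
  fixes a v l :: "real ^ 'r::finite"
  assumes card: "CARD('r) \<ge> 2" and gen: "generates g a" and pos: "\<And>i. 0 < a $ i"
    and lpos: "\<And>i. 0 < l $ i"
    and bal: "\<And>i j. i \<noteq> j \<Longrightarrow> l $ i * a $ i / g i j = l $ j * a $ j / g j i"
    and orth: "l \<bullet> v = 0" and small: "\<And>i. \<bar>v $ i\<bar> \<le> a $ i"
  shows "representable (a + v)"
proof -
  note gpos = generator_pos[OF gen pos]
  have g: "is_generator g" and a: "\<And>i. a $ i = (\<Prod>j\<in>UNIV - {i}. g i j)"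
    using gen by (auto simp: generates_def generated_tuple_def)
  have "(\<Sum>i\<in>UNIV. l $ i * v $ i) = 0" using orth by (simp add: inner_vec_def)
  then obtain u where antisym: "\<And>i j. u j i = - u i j"
    and row: "\<And>i. (\<Sum>j\<in>UNIV. u i j) = l $ i * v $ i"
    and u_pos: "\<And>i j. 0 \<le> l $ i * v $ i \<Longrightarrow> 0 \<le> u i j \<and> u i j \<le> l $ i * v $ i"
    and u_neg: "\<And>i j. l $ i * v $ i \<le> 0 \<Longrightarrow> l $ i * v $ i \<le> u i j \<and> u i j \<le> 0"
    by (rule antisymmetric_flow_exists) blast
  \<comment> \<open>Relative change of \<open>g i j\<close>, scaled so that row \<open>i\<close>
    sums to \<open>v $ i / a $ i\<close>.\<close>
  define y where "y i j = u i j / (l $ i * a $ i)" for i j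
  define h where "h i j = g i j * (1 + y i j)" for i j
  have la: "0 < l $ i * a $ i" for i using lpos pos by simp
  \<comment> \<open>The sign is that of \<open>v $ i\<close>; the lower bound -1 comes from
    \<open>\<bar>v $ i\<bar> \<le> a $ i\<close>.\<close>
  have sign: "(\<forall>j\<in>A. 0 \<le> y i j) \<or> (\<forall>j\<in>A. -1 \<le> y i j \<and> y i j \<le> 0)" for i A
  proof (cases "0 \<le> l $ i * v $ i")
    case True
    then show ?thesis using u_pos la[of i] by (simp add: y_def)
  next
    case False
    have "l $ i * (- a $ i) \<le> l $ i * v $ i"
      using small[of i] lpos[of i] by (intro mult_left_mono) auto
    then have "- (l $ i * a $ i) \<le> u i j" for j
      using u_neg[of i j] False by simp
    then show ?thesis using u_neg[of i] la[of i] False by (simp add: y_def le_divide_eq divide_le_0_iff)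
  qed
  have y_ge: "-1 \<le> y i j" for i j using sign[of "{j}" i] by auto
  have sum: "h i j + h j i = g i j + g j i" if ij: "i \<noteq> j" for i j
  proof -
    \<comment> \<open>Inverted, balance says that the factor turning flow into change of
      \<open>g i j\<close> is symmetric, so antisymmetric flow preserves pair sums.\<close>
    have "g i j / (l $ i * a $ i) = g j i / (l $ j * a $ j)"
      using arg_cong[OF bal[OF ij], of inverse] by simp
    then have "u i j * (g i j / (l $ i * a $ i)) + u j i * (g j i / (l $ j * a $ j)) = 0"
      using antisym[of i j] by simp
    then have "g i j * y i j + g j i * y j i = 0"
      by (simp add: y_def mult.commute)
    then show ?thesis by (simp add: h_def algebra_simps)
  qed
  have h_nonneg: "0 \<le> h i j" if "i \<noteq> j" for i j
    using gpos[OF that] y_ge[of i j] by (simp add: h_def)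
  have "is_generator h"
    unfolding is_generator_def
  proof (intro allI impI)
    fix i j :: 'r assume "i \<noteq> j"
    moreover from this have "g i j + g j i \<le> 1" using g by (simp add: is_generator_def)
    ultimately show "0 \<le> h i j \<and> h i j \<le> 1 \<and> h i j + h j i \<le> 1"
      using sum[of i j] h_nonneg[of i j] h_nonneg[of j i] by auto
  qed
  then have "representable (generated_tuple h)" by (auto simp: representable_def generates_def)
  moreover have "(a + v) $ i \<le> generated_tuple h $ i" for i
  proof -
    have "u i i = 0" using antisym[of i i] by simp
    then have "(\<Sum>j\<in>UNIV - {i}. u i j) = l $ i * v $ i"
      using row[of i] by (simp add: sum.remove[of UNIV i])
    then have "(\<Sum>j\<in>UNIV - {i}. y i j) = v $ i / a $ i"
      using lpos[of i] by (simp add: y_def sum_divide_distrib[symmetric])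
    then have "(a + v) $ i = a $ i * (1 + (\<Sum>j\<in>UNIV - {i}. y i j))"
      using pos[of i] by (simp add: field_simps)
    also have "\<dots> \<le> a $ i * (\<Prod>j\<in>UNIV - {i}. 1 + y i j)"
      using pos[of i] sign by (intro mult_left_mono one_plus_sum_le_prod) auto
    also have "\<dots> = generated_tuple h $ i"
      by (simp add: generated_tuple_def h_def prod.distrib a)
    finally show ?thesis .
  qed
  moreover have "0 \<le> (a + v) $ i" for i using small[of i] by simp
  ultimately show ?thesis using representable_mono[OF card] by blast
qed

theorem mainTheorem14:
  fixes a :: "real ^ 'r::finite" and g :: "'r \<Rightarrow> 'r \<Rightarrow> real"
  assumes "CARD('r) \<ge> 2"
    and "\<forall>i. 0 < a $ i \<and> a $ i < 1"
    and "maximal_representable a"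
    and "generates g a"
  shows "\<exists>\<epsilon>>0. \<forall>a'\<in>movement_space g a. norm (a' - a) \<le> \<epsilon> \<longrightarrow> representable a'"
proof -
  have pos: "0 < a $ i" for i using assms(2) by simp
  obtain l :: "real ^ 'r" where l: "\<And>i. 0 < l $ i"
    "\<And>i j. i \<noteq> j \<Longrightarrow> l $ i * a $ i / g i j = l $ j * a $ j / g j i"
    using maximal_imp_balanced[OF assms(3,4) pos] by blast
  have "l \<bullet> movement_vector g a i j = 0" if "i \<noteq> j" for i j
  proof -
    have "movement_vector g a i j = (a $ i / g i j) *\<^sub>R axis i 1 - (a $ j / g j i) *\<^sub>R axis j 1"
      using that by (auto simp: movement_vector_def vec_eq_iff axis_def)
    then show ?thesis using l(2)[OF that] by (simp add: inner_diff_right inner_axis mult.commute)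
  qed
  then have orth: "l \<bullet> (a' - a) = 0" if "a' \<in> movement_space g a" for a'
    using that by (auto simp: movement_space_def inner_sum_right intro!: sum.neutral)
  \<comment> \<open>The least entry of \<open>a\<close> suffices, since each coordinate of
    \<open>a' - a\<close> is bounded by its norm.\<close>
  define \<epsilon> where "\<epsilon> = Min (range (($) a))"
  have "0 < \<epsilon>" using pos by (simp add: \<epsilon>_def)
  moreover have "representable a'" if "a' \<in> movement_space g a" "norm (a' - a) \<le> \<epsilon>" for a'
  proof -
    have "\<bar>(a' - a) $ i\<bar> \<le> a $ i" for i
    proof -
      have "\<epsilon> \<le> a $ i" by (simp add: \<epsilon>_def)
      then show ?thesis using component_le_norm_cart[of "a' - a" i] that(2) by linarith
    qed
    then have "representable (a + (a' - a))"
      by (intro representable_add_balanced[OF assms(1,4) pos l orth[OF that(1)]])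
    then show ?thesis by simp
  qed
  ultimately show ?thesis by blast
qed

end
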